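(* Assume that $\mathcal{D}$ is an inclusion-closed collection and that the mean random dynamical system $\Phi$ on $L^p(\Omega,X)$ possesses an invariant weak $\mathcal{D}$-pullback mean random attractor $\mathcal{A}\in\mathcal{D}$. Then for every $t\in\mathbb{R}$ $$\mathcal{A}(t)=\{\phi(t):\phi\in\mathcal{D}\text{ is a complete trajectory}\}.$$
   Context: $X$ is a Banach space, $(\Omega,\mathcal{F},P)$ a probability space, $p\in(1,\infty)$, and $L^p(\Omega,X)$ the Banach space of Bochner integrable $y:\Omega\to X$ with $\int_\Omega\|y\|_X^p\,dP<\infty$. $\mathcal{D}$ is a given collection of families $D=\{D(t)\}_{t\in\mathbb{R}}$ of non-empty bounded sets $D(t)\subset L^p(\Omega,X)$; it is inclusion-closed if $D\in\mathcal{D}$ and $\emptyset\ne B(t)\subset D(t)$ ($B(t)$ bounded) for all $t$ imply $\{B(t)\}_{t\in\mathbb{R}}\in\mathcal{D}$. A mean random dynamical system is a family of maps $\Phi(t,\tau):L^p(\Omega,X)\to L^p(\Omega,X)$, $t\ge0$, $\tau\in\mathbb{R}$, with $\Phi(0,\tau)=\mathrm{id}$ and $\Phi(t+s,\tau)=\Phi(t,s+\tau)\circ\Phi(s,\tau)$ for $t,s\ge0$. $K\in\mathcal{D}$ is $\mathcal{D}$-pullback weakly attracting if for all $\tau\in\mathbb{R}$, $D\in\mathcal{D}$ and any weak neighborhood $\mathcal{N}^w(K(\tau))$ of $K(\tau)$ there is $T>0$ with $\Phi(t,\tau-t)D(\tau-t)\subset\mathcal{N}^w(K(\tau))$ for all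 $t\ge T$. $\mathcal{A}\in\mathcal{D}$ is a weak $\mathcal{D}$-pullback mean random attractor if (1) each $\mathcal{A}(t)$ is weakly compact; (2) $\mathcal{A}$ is $\mathcal{D}$-pullback weakly attracting; (3) if $B\in\mathcal{D}$ satisfies (1) and (2), then $\mathcal{A}(t)\subset B(t)$ for all $t$. It is invariant if $\mathcal{A}(t)=\Phi(\tau,t-\tau)\mathcal{A}(t-\tau)$ for all $\tau\ge0$, $t\in\mathbb{R}$. A map $\phi:\mathbb{R}\to L^p(\Omega,X)$ is a complete trajectory if $\phi(t)=\Phi(t-s,s)\phi(s)$ for all $s<t$; $\phi\in\mathcal{D}$ means that the family of singletons $\{\{\phi(t)\}\}_{t\in\mathbb{R}}$ belongs to $\mathcal{D}$. *)

theory Defs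
  imports "HOL-Probability.Probability"
begin

section \<open>The Bochner space \<open>L\<^sup>p(\<Omega>, X)\<close>\<close>

text \<open>
  The library's \<^const>\<open>integrable\<close> is restricted to second-countable (i.e. separable) target
  spaces; here \<open>X\<close> is an arbitrary real Banach space, so Bochner integrability is defined
  directly by approximation with simple functions. The almost everywhere convergence makes \<open>f\<close>
  strongly measurable up to a null set. This condition is needed, since the library's
  \<open>nn_integral\<close> of a non-measurable function is only a lower integral; for \<open>f\<close> as below
  the integrands are almost everywhere equal to measurable functions.
\<close>

definition bochner_integrable :: "'w measure \<Rightarrow> ('w \<Rightarrow> 'x::banach) \<Rightarrow> bool" where
  "bochner_integrable M f \<longleftrightarrow>
     (\<exists>s. (\<forall>i. Bochner_Integration.simple_bochner_integrable M (s i)) \<and>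
          (AE \<omega> in M. (\<lambda>i. s i \<omega>) \<longlonglongrightarrow> f \<omega>) \<and>
          (\<lambda>i. \<integral>\<^sup>+\<omega>. ennreal (norm (f \<omega> - s i \<omega>)) \<partial>M) \<longlonglongrightarrow> 0)"

definition Lp_fun :: "'w measure \<Rightarrow> real \<Rightarrow> ('w \<Rightarrow> 'x::banach) set" where
  "Lp_fun M p = {f. bochner_integrable M f \<and> (\<integral>\<^sup>+\<omega>. ennreal (norm (f \<omega>) powr p) \<partial>M) < \<infinity>}"

text \<open>Elements of \<open>L\<^sup>p\<close> are classes of functions modulo almost everywhere equality.\<close>

type_synonym ('w, 'x) Lp_elem = "('w \<Rightarrow> 'x) set"

definition Lp_class :: "'w measure \<Rightarrow> real \<Rightarrow> ('w \<Rightarrow> 'x::banach) \<Rightarrow> ('w, 'x) Lp_elem" where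
  "Lp_class M p f = {g \<in> Lp_fun M p. AE \<omega> in M. f \<omega> = g \<omega>}"

definition Lp_space :: "'w measure \<Rightarrow> real \<Rightarrow> ('w, 'x::banach) Lp_elem set" where
  "Lp_space M p = Lp_class M p ` Lp_fun M p"

definition Lp_norm :: "'w measure \<Rightarrow> real \<Rightarrow> ('w, 'x::banach) Lp_elem \<Rightarrow> real" where
  "Lp_norm M p u =
     the_elem ((\<lambda>f. enn2real (\<integral>\<^sup>+\<omega>. ennreal (norm (f \<omega>) powr p) \<partial>M) powr (1 / p)) ` u)"

lemma Lp_norm_class:
  assumes "f \<in> Lp_fun M p"
  shows "Lp_norm M p (Lp_class M p f) =
    enn2real (\<integral>\<^sup>+\<omega>. ennreal (norm (f \<omega>) powr p) \<partial>M) powr (1 / p)"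
proof -
  define n where "n g = enn2real (\<integral>\<^sup>+\<omega>. ennreal (norm (g \<omega>) powr p) \<partial>M) powr (1 / p)"
    for g :: "'a \<Rightarrow> 'b"
  have eq: "n g = n f" if "g \<in> Lp_class M p f" for g
  proof -
    have "(\<integral>\<^sup>+\<omega>. ennreal (norm (g \<omega>) powr p) \<partial>M) = (\<integral>\<^sup>+\<omega>. ennreal (norm (f \<omega>) powr p) \<partial>M)"
    proof (rule nn_integral_cong_AE)
      have "AE \<omega> in M. f \<omega> = g \<omega>"
        using that by (simp add: Lp_class_def)
      then show "AE \<omega> in M. ennreal (norm (g \<omega>) powr p) = ennreal (norm (f \<omega>) powr p)"
        by eventually_elim simp
    qed
    then show ?thesis
      by (simp only: n_def)
  qed
  have "f \<in> Lp_class M p f"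
    using assms by (simp add: Lp_class_def)
  then have "n ` Lp_class M p f = {n f}"
    using eq by blast
  then have "the_elem (n ` Lp_class M p f) = n f"
    by simp
  then show ?thesis
    by (simp only: Lp_norm_def n_def[abs_def])
qed

definition Lp_bounded :: "'w measure \<Rightarrow> real \<Rightarrow> ('w, 'x::banach) Lp_elem set \<Rightarrow> bool" where
  "Lp_bounded M p B \<longleftrightarrow> B \<subseteq> Lp_space M p \<and> (\<exists>C. \<forall>u\<in>B. Lp_norm M p u \<le> C)"

section \<open>The weak topology\<close>

text \<open>
  Continuous linear functionals on \<open>L\<^sup>p\<close>. The vector space operations on classes are written out
  through representatives; values of a functional outside \<open>Lp_space\<close> are irrelevant.
\<close>

definition Lp_dual :: "'w measure \<Rightarrow> real \<Rightarrow> (('w, 'x::banach) Lp_elem \<Rightarrow> real) set" where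
  "Lp_dual M p =
     {l. (\<forall>f\<in>Lp_fun M p. \<forall>g\<in>Lp_fun M p.
            l (Lp_class M p (\<lambda>\<omega>. f \<omega> + g \<omega>)) = l (Lp_class M p f) + l (Lp_class M p g)) \<and>
         (\<forall>c. \<forall>f\<in>Lp_fun M p. l (Lp_class M p (\<lambda>\<omega>. c *\<^sub>R f \<omega>)) = c * l (Lp_class M p f)) \<and>
         (\<exists>C. \<forall>u\<in>Lp_space M p. \<bar>l u\<bar> \<le> C * Lp_norm M p u)}"

definition Lp_weak :: "'w measure \<Rightarrow> real \<Rightarrow> ('w, 'x::banach) Lp_elem topology" where
  "Lp_weak M p =
     topology_generated_by {{u \<in> Lp_space M p. l u \<in> U} | l U. l \<in> Lp_dual M p \<and> open U}"

lemma topspace_Lp_weak: "topspace (Lp_weak M p) = Lp_space M p"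
proof (unfold Lp_weak_def topology_generated_by_topspace, rule equalityI)
  have "(\<lambda>_. 0) \<in> Lp_dual M p"
    unfolding Lp_dual_def by (rule CollectI, intro conjI ballI allI exI[of _ 0]) simp_all
  then have "{u \<in> Lp_space M p. (0::real) \<in> UNIV}
      \<in> {{u \<in> Lp_space M p. l u \<in> U} | l U. l \<in> Lp_dual M p \<and> open U}"
    using open_UNIV by blast
  then show "Lp_space M p \<subseteq> \<Union>{{u \<in> Lp_space M p. l u \<in> U} | l U. l \<in> Lp_dual M p \<and> open U}"
    by blast
qed blast

definition weak_nbhd ::
    "'w measure \<Rightarrow> real \<Rightarrow> ('w, 'x::banach) Lp_elem set \<Rightarrow> ('w, 'x) Lp_elem set \<Rightarrow> bool" where
  "weak_nbhd M p K N \<longleftrightarrow>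
     N \<subseteq> Lp_space M p \<and> (\<exists>U. openin (Lp_weak M p) U \<and> K \<subseteq> U \<and> U \<subseteq> N)"

section \<open>Mean random dynamical systems and weak pullback attractors\<close>

type_synonym ('w, 'x) Lp_family = "real \<Rightarrow> ('w, 'x) Lp_elem set"

type_synonym ('w, 'x) Lp_process = "real \<Rightarrow> real \<Rightarrow> ('w, 'x) Lp_elem \<Rightarrow> ('w, 'x) Lp_elem"

definition bounded_collection ::
    "'w measure \<Rightarrow> real \<Rightarrow> ('w, 'x::banach) Lp_family set \<Rightarrow> bool" where
  "bounded_collection M p \<D> \<longleftrightarrow> (\<forall>D\<in>\<D>. \<forall>t. D t \<noteq> {} \<and> Lp_bounded M p (D t))"

definition inclusion_closed ::
    "'w measure \<Rightarrow> real \<Rightarrow> ('w, 'x::banach) Lp_family set \<Rightarrow> bool" where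
  "inclusion_closed M p \<D> \<longleftrightarrow>
     (\<forall>D\<in>\<D>. \<forall>B. (\<forall>t. B t \<noteq> {} \<and> Lp_bounded M p (B t) \<and> B t \<subseteq> D t) \<longrightarrow> B \<in> \<D>)"

definition mean_rds :: "'w measure \<Rightarrow> real \<Rightarrow> ('w, 'x::banach) Lp_process \<Rightarrow> bool" where
  "mean_rds M p \<Phi> \<longleftrightarrow>
     (\<forall>t\<ge>0. \<forall>\<tau>. \<Phi> t \<tau> \<in> Lp_space M p \<rightarrow> Lp_space M p) \<and>
     (\<forall>\<tau>. \<forall>u\<in>Lp_space M p. \<Phi> 0 \<tau> u = u) \<and>
     (\<forall>t\<ge>0. \<forall>s\<ge>0. \<forall>\<tau>. \<forall>u\<in>Lp_space M p. \<Phi> (t + s) \<tau> u = \<Phi> t (s + \<tau>) (\<Phi> s \<tau> u))"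

definition pullback_weakly_attracting ::
    "'w measure \<Rightarrow> real \<Rightarrow> ('w, 'x::banach) Lp_process \<Rightarrow> ('w, 'x) Lp_family set \<Rightarrow>
     ('w, 'x) Lp_family \<Rightarrow> bool" where
  "pullback_weakly_attracting M p \<Phi> \<D> K \<longleftrightarrow> K \<in> \<D> \<and>
     (\<forall>\<tau>. \<forall>D\<in>\<D>. \<forall>N. weak_nbhd M p (K \<tau>) N \<longrightarrow>
        (\<exists>T>0. \<forall>t\<ge>T. \<Phi> t (\<tau> - t) ` D (\<tau> - t) \<subseteq> N))"

definition weak_pullback_attractor ::
    "'w measure \<Rightarrow> real \<Rightarrow> ('w, 'x::banach) Lp_process \<Rightarrow> ('w, 'x) Lp_family set \<Rightarrow>
     ('w, 'x) Lp_family \<Rightarrow> bool" where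
  "weak_pullback_attractor M p \<Phi> \<D> \<A> \<longleftrightarrow> \<A> \<in> \<D> \<and>
     (\<forall>t. compactin (Lp_weak M p) (\<A> t)) \<and>
     pullback_weakly_attracting M p \<Phi> \<D> \<A> \<and>
     (\<forall>B\<in>\<D>. (\<forall>t. compactin (Lp_weak M p) (B t)) \<and> pullback_weakly_attracting M p \<Phi> \<D> B \<longrightarrow>
        (\<forall>t. \<A> t \<subseteq> B t))"

definition invariant_family ::
    "('w, 'x) Lp_process \<Rightarrow> ('w, 'x) Lp_family \<Rightarrow> bool" where
  "invariant_family \<Phi> \<A> \<longleftrightarrow> (\<forall>\<tau>\<ge>0. \<forall>t. \<A> t = \<Phi> \<tau> (t - \<tau>) ` \<A> (t - \<tau>))"

definition complete_trajectory ::
    "'w measure \<Rightarrow> real \<Rightarrow> ('w, 'x::banach) Lp_process \<Rightarrow> (real \<Rightarrow> ('w, 'x) Lp_elem) \<Rightarrow> bool" where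
  "complete_trajectory M p \<Phi> \<phi> \<longleftrightarrow>
     (\<forall>t. \<phi> t \<in> Lp_space M p) \<and> (\<forall>s t. s < t \<longrightarrow> \<phi> t = \<Phi> (t - s) s (\<phi> s))"

end

theory Submission
  imports Defs "HOL-Library.Function_Algebras"
begin

text \<open>
  A point of \<open>\<A> t\<close> is pulled back step by step by invariance, which gives a complete trajectory inside
  \<open>\<A>\<close>; inclusion-closedness puts it in \<open>\<D>\<close>. Conversely, a complete trajectory in \<open>\<D>\<close> is an attracted
  family of singletons, so \<open>\<phi> t\<close> lies in every weak neighbourhood of \<open>\<A> t\<close>. If \<open>\<phi> t \<notin> \<A> t\<close>, the
  complement of \<open>\<phi> t\<close> is such a neighbourhood, because the weak topology is \<open>T\<^sub>1\<close>. The latter rests on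
  the Hahn--Banach theorem, applied on \<open>L\<^sup>p\<close> functions to the \<open>L\<^sup>1\<close> seminorm: this is subadditive
  without Minkowski's inequality and is dominated by the \<open>L\<^sup>p\<close> norm.
\<close>

section \<open>The Hahn--Banach theorem\<close>

text \<open>
  Zorn's lemma is applied to sublinear functionals. A minimal one \<open>m\<close> is linear: \<open>lower_along m y\<close> is
  sublinear and below \<open>m\<close>, hence equal to \<open>m\<close>, and taking \<open>t = 1\<close> in it gives
  \<open>m x + m y \<le> m (x + y)\<close>.
\<close>

locale real_subspace = vector_space scale
  for scale :: "real \<Rightarrow> 'b::ab_group_add \<Rightarrow> 'b" (infixr "\<odot>" 75) +
  fixes V :: "'b set"
  assumes subspace: "subspace V"
begin

lemma V_closed [simp, intro]:
  "0 \<in> V" "x \<in> V \<Longrightarrow> y \<in> V \<Longrightarrow> x + y \<in> V" "x \<in> V \<Longrightarrow> c \<odot> x \<in> V" "x \<in> V \<Longrightarrow> - x \<in> V"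
  using subspace by (auto simp: subspace_0 subspace_add subspace_scale subspace_neg)

section \<open>Sublinear functionals and their lowering along a direction\<close>

definition sublinear :: "('b \<Rightarrow> real) \<Rightarrow> bool" where
  "sublinear q \<longleftrightarrow> (\<forall>x\<in>V. \<forall>y\<in>V. q (x + y) \<le> q x + q y) \<and> (\<forall>c\<ge>0. \<forall>x\<in>V. q (c \<odot> x) \<le> c * q x)"

lemma sublinear_add: "sublinear q \<Longrightarrow> x \<in> V \<Longrightarrow> y \<in> V \<Longrightarrow> q (x + y) \<le> q x + q y"
  and sublinear_scale_le: "sublinear q \<Longrightarrow> x \<in> V \<Longrightarrow> 0 \<le> c \<Longrightarrow> q (c \<odot> x) \<le> c * q x"
  by (auto simp: sublinear_def)

lemma sublinear_0:
  assumes "sublinear q"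
  shows "q 0 = 0"
  using sublinear_add[OF assms, of 0 0] sublinear_scale_le[OF assms, of 0 0] by simp

lemma sublinear_neg:
  assumes "sublinear q" "x \<in> V"
  shows "- q (- x) \<le> q x"
  using sublinear_add[OF assms(1), of x "- x"] assms sublinear_0[OF assms(1)] by simp

text \<open>For positive \<open>c\<close>, the defining inequality applied to
  \<open>c \<odot> x\<close> with factor \<open>inverse c\<close> gives the reverse one. Keeping a
  single inequality in the definition shortens the checks for infima below.\<close>

lemma sublinear_scale:
  assumes q: "sublinear q" and x: "x \<in> V" and c: "0 \<le> c"
  shows "q (c \<odot> x) = c * q x"
proof (cases "c = 0")
  case True
  then show ?thesis using sublinear_0[OF q] by simp
next
  case False
  with c have "0 < c" by simp
  then have "q x \<le> inverse c * q (c \<odot> x)"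
    using sublinear_scale_le[OF q, of "c \<odot> x" "inverse c"] x by simp
  then have "c * q x \<le> q (c \<odot> x)"
    using \<open>0 < c\<close> by (simp add: field_simps)
  then show ?thesis
    using sublinear_scale_le[OF q x c] by simp
qed

text \<open>Lowers \<open>q\<close> so that a dominated linear functional must equal
  \<open>q\<close> at \<open>y\<close>: the choice \<open>t = 1\<close> bounds the value at
  \<open>- y\<close> by \<open>- q y\<close>, while \<open>t = 0\<close> keeps the result below
  \<open>q\<close>.\<close>

definition lower_along :: "('b \<Rightarrow> real) \<Rightarrow> 'b \<Rightarrow> 'b \<Rightarrow> real" where
  "lower_along q y x = (INF t\<in>{0..}. q (x + t \<odot> y) - t * q y)"

lemma lower_along_le:
  assumes q: "sublinear q" and V: "x \<in> V" "y \<in> V" and "0 \<le> t"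
  shows "lower_along q y x \<le> q (x + t \<odot> y) - t * q y"
proof -
  \<comment> \<open>The real infimum needs a lower bound. From \<open>s * q y = q (s \<odot> y)
    \<le> q (x + s \<odot> y) + q (- x)\<close> comes \<open>- q (- x)\<close>, independent of
    \<open>s\<close>.\<close>
  have "- q (- x) \<le> q (x + s \<odot> y) - s * q y" if "0 \<le> s" for s
    using sublinear_add[OF q, of "x + s \<odot> y" "- x"] sublinear_scale[OF q, of y s] V that by simp
  then have "bdd_below ((\<lambda>t. q (x + t \<odot> y) - t * q y) ` {0..})"
    by (intro bdd_belowI2) auto
  then show ?thesis
    unfolding lower_along_def using \<open>0 \<le> t\<close> by (intro cINF_lower) auto
qed

lemma lower_along_greatest:
  assumes "\<And>t. 0 \<le> t \<Longrightarrow> m \<le> q (x + t \<odot> y) - t * q y"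
  shows "m \<le> lower_along q y x"
  unfolding lower_along_def using assms by (intro cINF_greatest) auto

lemma lower_along_le_self:
  assumes "sublinear q" "x \<in> V" "y \<in> V"
  shows "lower_along q y x \<le> q x"
  using lower_along_le[OF assms, of 0] by simp

text \<open>Parameters \<open>s\<close> for \<open>x\<close> and \<open>t\<close> for
  \<open>z\<close> combine to \<open>s + t\<close> for \<open>x + z\<close>, and \<open>t\<close>
  for \<open>x\<close> becomes \<open>c * t\<close> for \<open>c \<odot> x\<close>. The bounds hold
  for all parameters, so infima can be taken one at a time.\<close>

lemma sublinear_lower_along:
  assumes q: "sublinear q" and y: "y \<in> V"
  shows "sublinear (lower_along q y)"
  unfolding sublinear_def
proof (intro conjI ballI allI impI)
  fix x z assume V: "x \<in> V" "z \<in> V"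
  have *: "lower_along q y (x + z) \<le> (q (x + s \<odot> y) - s * q y) + (q (z + t \<odot> y) - t * q y)"
    if "0 \<le> s" "0 \<le> t" for s t
  proof -
    have "lower_along q y (x + z) \<le> q ((x + z) + (s + t) \<odot> y) - (s + t) * q y"
      using lower_along_le[OF q] V y that by simp
    also have "(x + z) + (s + t) \<odot> y = (x + s \<odot> y) + (z + t \<odot> y)"
      by (simp add: scale_left_distrib algebra_simps)
    finally show ?thesis
      using sublinear_add[OF q, of "x + s \<odot> y" "z + t \<odot> y"] V y by (simp add: algebra_simps)
  qed
  have "lower_along q y (x + z) - (q (x + s \<odot> y) - s * q y) \<le> lower_along q y z" if "0 \<le> s" for s
    using *[OF that] by (intro lower_along_greatest) (simp add: algebra_simps)
  then have "lower_along q y (x + z) - lower_along q y z \<le> lower_along q y x"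
    by (intro lower_along_greatest) (simp add: algebra_simps)
  then show "lower_along q y (x + z) \<le> lower_along q y x + lower_along q y z"
    by simp
next
  fix c :: real and x assume c: "0 \<le> c" and x: "x \<in> V"
  have *: "lower_along q y (c \<odot> x) \<le> c * (q (x + t \<odot> y) - t * q y)" if "0 \<le> t" for t
  proof -
    have "lower_along q y (c \<odot> x) \<le> q (c \<odot> x + (c * t) \<odot> y) - (c * t) * q y"
      using lower_along_le[OF q] x y c that by simp
    also have "c \<odot> x + (c * t) \<odot> y = c \<odot> (x + t \<odot> y)"
      by (simp add: scale_right_distrib)
    finally show ?thesis
      using sublinear_scale[OF q _ c, of "x + t \<odot> y"] x y by (simp add: algebra_simps)
  qed
  show "lower_along q y (c \<odot> x) \<le> c * lower_along q y x"
  proof (cases "c = 0")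
    case True
    with *[of 0] show ?thesis by simp
  next
    case False
    then have "lower_along q y (c \<odot> x) / c \<le> lower_along q y x"
      using c * by (intro lower_along_greatest) (simp add: field_simps)
    then show ?thesis
      using c False by (simp add: field_simps)
  qed
qed

section \<open>Zorn's lemma and linear functionals dominated by a sublinear one\<close>

lemma minimal_sublinear_exists:
  assumes q: "sublinear q"
  shows "\<exists>m. sublinear m \<and> (\<forall>x\<in>V. m x \<le> q x) \<and>
    (\<forall>r. sublinear r \<and> (\<forall>x\<in>V. r x \<le> m x) \<longrightarrow> (\<forall>x\<in>V. r x = m x))"
proof -
  \<comment> \<open>Functionals are normalised to \<open>0\<close> off \<open>V\<close>, so that the pointwise order is antisymmetric.\<close>
  define A where "A = {r. sublinear r \<and> (\<forall>x\<in>V. r x \<le> q x) \<and> (\<forall>x. x \<notin> V \<longrightarrow> r x = 0)}"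
  \<comment> \<open>The order is reversed: larger in \<open>P\<close> means pointwise smaller, so
    Zorn's maximal element is a minimal functional and chains are bounded by their infima.\<close>
  define P where "P a b \<longleftrightarrow> (\<forall>x. b x \<le> a x)" for a b :: "'b \<Rightarrow> real"
  define cut where "cut r x = (if x \<in> V then r x else 0)" for r :: "'b \<Rightarrow> real" and x
  have cut: "sublinear (cut r)" if "sublinear r" for r
    using that by (auto simp: sublinear_def cut_def)
  have "\<exists>m\<in>A. \<forall>a\<in>A. P m a \<longrightarrow> a = m"
  proof (rule predicate_Zorn)
    show "partial_order_on A (relation_of P A)"
    proof (rule partial_order_on_relation_ofI)
      show "P a a" for a
        by (simp add: P_def)
      show "P a c" if "P a b" "P b c" for a b c
        using that unfolding P_def by (blast intro: order_trans)
      show "a = b" if "P a b" "P b a" for a b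
        using that unfolding P_def by (intro ext order_antisym) auto
    qed
  next
    fix C assume C: "C \<in> Chains (relation_of P A)"
    have CA: "C \<subseteq> A" using C by (rule Chains_relation_of)
    show "\<exists>u\<in>A. \<forall>a\<in>C. P a u"
    proof (cases "C = {}")
      case True
      have "cut q \<in> A" using cut[OF q] by (auto simp: A_def cut_def)
      with True show ?thesis by blast
    next
      case False
      define u where "u x = (INF r\<in>C. r x)" for x
      have low: "u x \<le> r x" if "r \<in> C" for r x
      proof -
        \<comment> \<open>On \<open>V\<close>, every chain member satisfies
          \<open>r' x \<ge> - r' (- x) \<ge> - q (- x)\<close>, a bound common to the chain.\<close>
        have "(if x \<in> V then - q (- x) else 0) \<le> r' x" if "r' \<in> C" for r'
        proof (cases "x \<in> V")
          case True
          have "r' \<in> A" using that CA by blast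
          then have "- r' (- x) \<le> r' x" "r' (- x) \<le> q (- x)"
            using True sublinear_neg[of r' x] by (auto simp: A_def)
          with True show ?thesis by simp
        next
          case False
          with that CA show ?thesis by (auto simp: A_def)
        qed
        then have "bdd_below ((\<lambda>r. r x) ` C)" by (rule bdd_belowI2)
        then show ?thesis unfolding u_def using that by (rule cINF_lower)
      qed
      have great: "b \<le> u x" if "\<And>r. r \<in> C \<Longrightarrow> b \<le> r x" for b x
        unfolding u_def using False that by (intro cINF_greatest) auto
      have "sublinear u"
        unfolding sublinear_def
      proof (intro conjI ballI allI impI)
        fix x y assume V: "x \<in> V" "y \<in> V"
        \<comment> \<open>Of two comparable members the smaller one serves at both points, so its
          subadditivity bounds the mixed sum.\<close>
        have *: "u (x + y) \<le> r x + s y" if rs: "r \<in> C" "s \<in> C" for r s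
        proof -
          have sub: "sublinear r" "sublinear s"
            using rs CA by (auto simp: A_def)
          from C rs have "P r s \<or> P s r"
            by (auto simp: Chains_def relation_of_def)
          then show ?thesis
          proof
            assume "P r s"
            then have "s x \<le> r x" by (simp add: P_def)
            then show ?thesis
              using low[OF rs(2), of "x + y"] sublinear_add[OF sub(2) V] by simp
          next
            assume "P s r"
            then have "r y \<le> s y" by (simp add: P_def)
            then show ?thesis
              using low[OF rs(1), of "x + y"] sublinear_add[OF sub(1) V] by simp
          qed
        qed
        have "u (x + y) - r x \<le> u y" if "r \<in> C" for r
          using *[OF that] by (intro great) (simp add: algebra_simps)
        then have "u (x + y) - u y \<le> u x"
          by (intro great) (simp add: algebra_simps)
        then show "u (x + y) \<le> u x + u y" by simp
      next
        fix c :: real and x assume c: "0 \<le> c" and x: "x \<in> V"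
        have *: "u (c \<odot> x) \<le> c * r x" if "r \<in> C" for r
        proof -
          have "sublinear r" using that CA by (auto simp: A_def)
          then show ?thesis
            using low[OF that, of "c \<odot> x"] sublinear_scale[of r x c] x c by simp
        qed
        show "u (c \<odot> x) \<le> c * u x"
        proof (cases "c = 0")
          case True
          from False obtain r where "r \<in> C" by blast
          from *[OF this] True show ?thesis by simp
        next
          case False
          with c have "u (c \<odot> x) / c \<le> r x" if "r \<in> C" for r
            using *[OF that] by (simp add: field_simps)
          then have "u (c \<odot> x) / c \<le> u x" by (rule great)
          then show ?thesis using c False by (simp add: field_simps)
        qed
      qed
      moreover have "u x \<le> q x" if "x \<in> V" for x
      proof -
        from False obtain r where r: "r \<in> C" by blast
        with CA that have "r x \<le> q x" by (auto simp: A_def)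
        with low[OF r, of x] show ?thesis by simp
      qed
      moreover have "u x = 0" if "x \<notin> V" for x
      proof -
        have r: "r x = 0" if "r \<in> C" for r
          using that CA \<open>x \<notin> V\<close> by (auto simp: A_def)
        from False obtain r where "r \<in> C" by blast
        then have "u x \<le> 0" using low[of r x] r[of r] by linarith
        moreover have "0 \<le> s x" if "s \<in> C" for s using r[OF that] by simp
        then have "0 \<le> u x" by (rule great)
        ultimately show ?thesis by simp
      qed
      ultimately have "u \<in> A" by (simp add: A_def)
      then show ?thesis using low unfolding P_def by blast
    qed
  qed
  then obtain m where m: "m \<in> A" and min: "\<And>a. a \<in> A \<Longrightarrow> P m a \<Longrightarrow> a = m" by blast
  \<comment> \<open>A functional below \<open>m\<close> on \<open>V\<close> is below
    \<open>q\<close> as well, so its normalisation lies in \<open>A\<close> and competes with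
    \<open>m\<close>.\<close>
  have minimal: "r x = m x" if r: "sublinear r" "\<And>z. z \<in> V \<Longrightarrow> r z \<le> m z" and x: "x \<in> V" for r x
  proof -
    have "r z \<le> q z" if "z \<in> V" for z
      using order_trans[OF r(2)[OF that], of "q z"] m that by (simp add: A_def)
    then have "cut r \<in> A"
      using cut[OF r(1)] by (simp add: A_def cut_def)
    moreover have "P m (cut r)"
      unfolding P_def cut_def using r(2) m by (simp add: A_def)
    ultimately have "cut r = m" by (rule min)
    then have "cut r x = m x" by (rule fun_cong)
    then show ?thesis using x by (simp add: cut_def)
  qed
  show ?thesis
  proof (intro exI[of _ m] conjI ballI allI impI)
    show "sublinear m"
      using m by (simp add: A_def)
    show "m x \<le> q x" if "x \<in> V" for x
      using m that by (simp add: A_def)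
    show "r x = m x" if "sublinear r \<and> (\<forall>x\<in>V. r x \<le> m x)" "x \<in> V" for r x
      using that by (intro minimal) auto
  qed
qed

text \<open>The minimal functional is taken below \<open>lower_along q y\<close> instead of
  \<open>q\<close>. This yields \<open>L (- y) \<le> - q y\<close>, and linearity turns domination
  into equality at \<open>y\<close>.\<close>

theorem hahn_banach:
  assumes q: "sublinear q" and y: "y \<in> V"
  obtains L where "\<And>x z. x \<in> V \<Longrightarrow> z \<in> V \<Longrightarrow> L (x + z) = L x + L z"
    "\<And>c x. x \<in> V \<Longrightarrow> L (c \<odot> x) = c * L x" "\<And>x. x \<in> V \<Longrightarrow> L x \<le> q x" "L y = q y"
proof -
  obtain L where L: "sublinear L" and le: "\<And>x. x \<in> V \<Longrightarrow> L x \<le> lower_along q y x"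
    and min: "\<forall>r. sublinear r \<and> (\<forall>x\<in>V. r x \<le> L x) \<longrightarrow> (\<forall>x\<in>V. r x = L x)"
    using minimal_sublinear_exists[OF sublinear_lower_along[OF q y]] by blast
  have add: "L (x + z) = L x + L z" if V: "x \<in> V" "z \<in> V" for x z
  proof -
    have "lower_along L z x = L x"
      using min sublinear_lower_along[OF L V(2)] lower_along_le_self[OF L _ V(2)] V(1) by blast
    then show ?thesis
      using lower_along_le[OF L V, of 1] sublinear_add[OF L V] by simp
  qed
  have neg: "L (- x) = - L x" if "x \<in> V" for x
    using add[of x "- x"] that sublinear_0[OF L] by simp
  have scale: "L (c \<odot> x) = c * L x" if "x \<in> V" for c x
  proof (cases "0 \<le> c")
    case True
    then show ?thesis using sublinear_scale[OF L that] by simp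
  next
    case False
    then have "L (- ((- c) \<odot> x)) = c * L x"
      using neg[of "(- c) \<odot> x"] sublinear_scale[OF L that, of "- c"] that by simp
    then show ?thesis by simp
  qed
  have bound: "L x \<le> q x" if "x \<in> V" for x
    using le[OF that] lower_along_le_self[OF q that y] by simp
  have "L (- y) \<le> - q y"
    using le[of "- y"] lower_along_le[OF q _ y, of "- y" 1] sublinear_0[OF q] y by simp
  then have "L y = q y"
    using neg[OF y] bound[OF y] by simp
  with that add scale bound show thesis by blast
qed

end

section \<open>Functionals on \<open>L\<^sup>p\<close>\<close>

lemma borel_measurable_completion_AE_eq:
  fixes f g :: "'w \<Rightarrow> 'b::topological_space"
  assumes g: "g \<in> borel_measurable (completion M)" and ae: "AE \<omega> in M. f \<omega> = g \<omega>"
  shows "f \<in> borel_measurable (completion M)"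
proof (rule measurableI)
  fix S :: "'b set" assume [measurable]: "S \<in> sets borel"
  note [measurable] = g
  \<comment> \<open>Both exceptional sets lie in a null set, hence are measurable in the completion.
    Exchanging them turns the preimage under \<open>g\<close> into that under
    \<open>f\<close>.\<close>
  have [measurable]: "Measurable.pred (completion M) (\<lambda>\<omega>. f \<omega> \<noteq> g \<omega> \<and> f \<omega> \<in> S)"
    "Measurable.pred (completion M) (\<lambda>\<omega>. f \<omega> \<noteq> g \<omega> \<and> g \<omega> \<in> S)"
    using ae by (auto intro!: sets_completion_AE elim: eventually_mono)
  have "Measurable.pred (completion M)
    (\<lambda>\<omega>. (f \<omega> \<noteq> g \<omega> \<and> f \<omega> \<in> S) \<or> g \<omega> \<in> S \<and> \<not> (f \<omega> \<noteq> g \<omega> \<and> g \<omega> \<in> S))"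
    by measurable
  also have "(\<lambda>\<omega>. (f \<omega> \<noteq> g \<omega> \<and> f \<omega> \<in> S) \<or> g \<omega> \<in> S \<and> \<not> (f \<omega> \<noteq> g \<omega> \<and> g \<omega> \<in> S)) = (\<lambda>\<omega>. f \<omega> \<in> S)"
    by auto
  finally show "f -` S \<inter> space (completion M) \<in> sets (completion M)"
    by (simp add: pred_def vimage_def Int_def conj_commute)
qed simp

text \<open>Taking norms before the limit leaves only real-valued functions, so the target space may
  be nonseparable. The pointwise \<open>lim\<close> is measurable even off the set of convergence,
  and the completion absorbs the null set.\<close>

lemma norm_AE_limit_measurable:
  fixes s :: "nat \<Rightarrow> 'w \<Rightarrow> 'x::real_normed_vector"
  assumes s: "\<And>i. simple_function M (s i)" and lim: "AE \<omega> in M. (\<lambda>i. s i \<omega>) \<longlonglongrightarrow> f \<omega>"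
  shows "(\<lambda>\<omega>. norm (f \<omega>)) \<in> borel_measurable (completion M)"
proof (rule borel_measurable_completion_AE_eq)
  have "(\<lambda>\<omega>. norm (s i \<omega>)) \<in> borel_measurable M" for i
    using simple_function_compose1[OF s] by (rule borel_measurable_simple_function)
  then have "(\<lambda>\<omega>. lim (\<lambda>i. norm (s i \<omega>))) \<in> borel_measurable M"
    by (rule borel_measurable_lim_metric)
  then show "(\<lambda>\<omega>. lim (\<lambda>i. norm (s i \<omega>))) \<in> borel_measurable (completion M)"
    by (rule measurable_completion)
  show "AE \<omega> in M. norm (f \<omega>) = lim (\<lambda>i. norm (s i \<omega>))"
    using lim by eventually_elim (metis limI tendsto_norm)
qed

lemma norm_bochner_diff_measurable:
  assumes f: "bochner_integrable M f" and t: "simple_function M t"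
  shows "(\<lambda>\<omega>. norm (f \<omega> - t \<omega>)) \<in> borel_measurable (completion M)"
proof -
  obtain s where s: "\<And>i. simple_function M (s i)" and lim: "AE \<omega> in M. (\<lambda>i. s i \<omega>) \<longlonglongrightarrow> f \<omega>"
    using f by (auto simp: bochner_integrable_def Bochner_Integration.simple_bochner_integrable.simps)
  show ?thesis
  proof (rule norm_AE_limit_measurable)
    show "simple_function M (\<lambda>\<omega>. s i \<omega> - t \<omega>)" for i
      by (rule simple_function_compose2[where h = "(-)", OF s t])
    show "AE \<omega> in M. (\<lambda>i. s i \<omega> - t \<omega>) \<longlonglongrightarrow> f \<omega> - t \<omega>"
      using lim by eventually_elim (intro tendsto_intros)
  qed
qed

lemma norm_bochner_measurable:
  assumes "bochner_integrable M f"
  shows "(\<lambda>\<omega>. norm (f \<omega>)) \<in> borel_measurable (completion M)"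
  using norm_bochner_diff_measurable[OF assms, of "\<lambda>_. 0"] by simp

section \<open>Vector space operations on Bochner integrable functions and on
  \<open>Lp_fun\<close>\<close>

lemma bochner_integrable_add:
  assumes f: "bochner_integrable M f" and g: "bochner_integrable M g"
  shows "bochner_integrable M (\<lambda>\<omega>. f \<omega> + g \<omega>)"
proof -
  obtain s where s: "\<And>i. Bochner_Integration.simple_bochner_integrable M (s i)"
    "AE \<omega> in M. (\<lambda>i. s i \<omega>) \<longlonglongrightarrow> f \<omega>"
    "(\<lambda>i. \<integral>\<^sup>+\<omega>. ennreal (norm (f \<omega> - s i \<omega>)) \<partial>M) \<longlonglongrightarrow> 0"
    using f by (auto simp: bochner_integrable_def)
  obtain t where t: "\<And>i. Bochner_Integration.simple_bochner_integrable M (t i)"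
    "AE \<omega> in M. (\<lambda>i. t i \<omega>) \<longlonglongrightarrow> g \<omega>"
    "(\<lambda>i. \<integral>\<^sup>+\<omega>. ennreal (norm (g \<omega> - t i \<omega>)) \<partial>M) \<longlonglongrightarrow> 0"
    using g by (auto simp: bochner_integrable_def)
  have simp_st: "simple_function M (s i)" "simple_function M (t i)" for i
    using s(1) t(1) by (auto simp: Bochner_Integration.simple_bochner_integrable.simps)
  have [measurable]: "(\<lambda>\<omega>. norm (f \<omega> - s i \<omega>)) \<in> borel_measurable (completion M)"
    "(\<lambda>\<omega>. norm (g \<omega> - t i \<omega>)) \<in> borel_measurable (completion M)" for i
    using f g simp_st by (auto intro: norm_bochner_diff_measurable)
  have le: "(\<integral>\<^sup>+\<omega>. ennreal (norm (f \<omega> + g \<omega> - (s i \<omega> + t i \<omega>))) \<partial>M) \<le>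
    (\<integral>\<^sup>+\<omega>. ennreal (norm (f \<omega> - s i \<omega>)) \<partial>M) + (\<integral>\<^sup>+\<omega>. ennreal (norm (g \<omega> - t i \<omega>)) \<partial>M)" for i
  proof -
    \<comment> \<open>Over the completion the error norms are measurable, so the integral is
      additive there; \<open>nn_integral_completion\<close> carries the result back to
      \<open>M\<close>.\<close>
    have "(\<integral>\<^sup>+\<omega>. ennreal (norm (f \<omega> + g \<omega> - (s i \<omega> + t i \<omega>))) \<partial>completion M) \<le>
      (\<integral>\<^sup>+\<omega>. ennreal (norm (f \<omega> - s i \<omega>)) + ennreal (norm (g \<omega> - t i \<omega>)) \<partial>completion M)"
      by (intro nn_integral_mono)
        (simp add: ennreal_plus[symmetric] norm_diff_triangle_ineq del: ennreal_plus)
    also have "\<dots> = (\<integral>\<^sup>+\<omega>. ennreal (norm (f \<omega> - s i \<omega>)) \<partial>completion M)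
        + (\<integral>\<^sup>+\<omega>. ennreal (norm (g \<omega> - t i \<omega>)) \<partial>completion M)"
      by (intro nn_integral_add) measurable
    finally show ?thesis by (simp only: nn_integral_completion)
  qed
  have lim: "(\<lambda>i. (\<integral>\<^sup>+\<omega>. ennreal (norm (f \<omega> - s i \<omega>)) \<partial>M)
      + (\<integral>\<^sup>+\<omega>. ennreal (norm (g \<omega> - t i \<omega>)) \<partial>M)) \<longlonglongrightarrow> 0"
    using tendsto_add[OF s(3) t(3)] by (simp only: add_0)
  have "(\<lambda>i. \<integral>\<^sup>+\<omega>. ennreal (norm (f \<omega> + g \<omega> - (s i \<omega> + t i \<omega>))) \<partial>M) \<longlonglongrightarrow> 0"
    by (rule tendsto_sandwich[OF _ always_eventually[OF allI[OF le]] tendsto_const lim]) simp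
  moreover have "AE \<omega> in M. (\<lambda>i. s i \<omega> + t i \<omega>) \<longlonglongrightarrow> f \<omega> + g \<omega>"
    using s(2) t(2) by eventually_elim (rule tendsto_add)
  moreover have "Bochner_Integration.simple_bochner_integrable M (\<lambda>\<omega>. s i \<omega> + t i \<omega>)" for i
    by (rule simple_bochner_integrable_compose2[where p = "(+)", OF _ s(1) t(1)]) simp
  ultimately show ?thesis
    unfolding bochner_integrable_def by (intro exI[of _ "\<lambda>i \<omega>. s i \<omega> + t i \<omega>"]) auto
qed

lemma nn_integral_norm_scaleR:
  assumes [measurable]: "(\<lambda>\<omega>. norm (f \<omega>)) \<in> borel_measurable (completion M)"
  shows "(\<integral>\<^sup>+\<omega>. ennreal (norm (c *\<^sub>R f \<omega>)) \<partial>M) = ennreal \<bar>c\<bar> * (\<integral>\<^sup>+\<omega>. ennreal (norm (f \<omega>)) \<partial>M)"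
proof -
  have "(\<integral>\<^sup>+\<omega>. ennreal (norm (c *\<^sub>R f \<omega>)) \<partial>completion M)
    = (\<integral>\<^sup>+\<omega>. ennreal \<bar>c\<bar> * ennreal (norm (f \<omega>)) \<partial>completion M)"
    by (simp add: ennreal_mult)
  also have "\<dots> = ennreal \<bar>c\<bar> * (\<integral>\<^sup>+\<omega>. ennreal (norm (f \<omega>)) \<partial>completion M)"
    by (intro nn_integral_cmult) measurable
  finally show ?thesis by (simp only: nn_integral_completion)
qed

lemma bochner_integrable_scaleR:
  assumes f: "bochner_integrable M f"
  shows "bochner_integrable M (\<lambda>\<omega>. c *\<^sub>R f \<omega>)"
proof -
  obtain s where s: "\<And>i. Bochner_Integration.simple_bochner_integrable M (s i)"
    "AE \<omega> in M. (\<lambda>i. s i \<omega>) \<longlonglongrightarrow> f \<omega>"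
    "(\<lambda>i. \<integral>\<^sup>+\<omega>. ennreal (norm (f \<omega> - s i \<omega>)) \<partial>M) \<longlonglongrightarrow> 0"
    using f by (auto simp: bochner_integrable_def)
  have "simple_function M (s i)" for i
    using s(1) by (auto simp: Bochner_Integration.simple_bochner_integrable.simps)
  then have "(\<integral>\<^sup>+\<omega>. ennreal (norm (c *\<^sub>R f \<omega> - c *\<^sub>R s i \<omega>)) \<partial>M) =
      ennreal \<bar>c\<bar> * (\<integral>\<^sup>+\<omega>. ennreal (norm (f \<omega> - s i \<omega>)) \<partial>M)" for i
    using nn_integral_norm_scaleR[OF norm_bochner_diff_measurable[OF f], of "s i" c]
    by (simp add: scaleR_diff_right)
  moreover have "(\<lambda>i. ennreal \<bar>c\<bar> * (\<integral>\<^sup>+\<omega>. ennreal (norm (f \<omega> - s i \<omega>)) \<partial>M)) \<longlonglongrightarrow> ennreal \<bar>c\<bar> * 0"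
    by (rule ennreal_tendsto_cmult[OF _ s(3)]) simp
  moreover have "AE \<omega> in M. (\<lambda>i. c *\<^sub>R s i \<omega>) \<longlonglongrightarrow> c *\<^sub>R f \<omega>"
    using s(2) by eventually_elim (intro tendsto_intros)
  \<comment> \<open>The binary closure rule is used with a map that ignores its second
    argument.\<close>
  moreover have "Bochner_Integration.simple_bochner_integrable M (\<lambda>\<omega>. c *\<^sub>R s i \<omega>)" for i
    by (rule simple_bochner_integrable_compose2[where p = "\<lambda>x y. c *\<^sub>R x", OF _ s(1) s(1)]) simp
  ultimately show ?thesis
    unfolding bochner_integrable_def by (intro exI[of _ "\<lambda>i \<omega>. c *\<^sub>R s i \<omega>"]) auto
qed

lemma Lp_fun_zero: "(\<lambda>_. 0) \<in> Lp_fun M p"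
proof -
  have "Bochner_Integration.simple_bochner_integrable M (\<lambda>_. 0)"
    by (rule Bochner_Integration.simple_bochner_integrable.intros) auto
  then show ?thesis
    by (auto simp: Lp_fun_def bochner_integrable_def intro!: exI[of _ "\<lambda>_ _. 0"])
qed

lemma Lp_fun_add:
  assumes p: "1 \<le> p" and f: "f \<in> Lp_fun M p" and g: "g \<in> Lp_fun M p"
  shows "(\<lambda>\<omega>. f \<omega> + g \<omega>) \<in> Lp_fun M p"
proof -
  have [measurable]: "(\<lambda>\<omega>. norm (f \<omega>)) \<in> borel_measurable (completion M)"
    "(\<lambda>\<omega>. norm (g \<omega>)) \<in> borel_measurable (completion M)"
    using f g by (auto simp: Lp_fun_def intro: norm_bochner_measurable)
  \<comment> \<open>Only finiteness is at stake, so the crude bound by twice the larger norm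
    suffices; the power of a maximum is at most the sum of the powers.\<close>
  have le: "norm (x + y) powr p \<le> 2 powr p * (norm x powr p + norm y powr p)" for x y :: 'b
  proof -
    have "norm (x + y) powr p \<le> (2 * max (norm x) (norm y)) powr p"
      using norm_triangle_ineq[of x y] p by (intro powr_mono2) auto
    also have "\<dots> = 2 powr p * max (norm x) (norm y) powr p"
      by (simp add: powr_mult)
    also have "\<dots> \<le> 2 powr p * (norm x powr p + norm y powr p)"
      by (intro mult_left_mono) (auto simp: max_def)
    finally show ?thesis .
  qed
  have "(\<integral>\<^sup>+\<omega>. ennreal (norm (f \<omega> + g \<omega>) powr p) \<partial>completion M) \<le>
    (\<integral>\<^sup>+\<omega>. ennreal (2 powr p) * (ennreal (norm (f \<omega>) powr p) + ennreal (norm (g \<omega>) powr p)) \<partial>completion M)"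
    using le by (intro nn_integral_mono)
      (simp add: ennreal_plus[symmetric] ennreal_mult[symmetric] del: ennreal_plus)
  also have "\<dots> = ennreal (2 powr p) * ((\<integral>\<^sup>+\<omega>. ennreal (norm (f \<omega>) powr p) \<partial>completion M)
      + (\<integral>\<^sup>+\<omega>. ennreal (norm (g \<omega>) powr p) \<partial>completion M))"
    by (simp add: nn_integral_cmult nn_integral_add)
  also have "\<dots> < \<infinity>"
    using f g by (simp add: nn_integral_completion Lp_fun_def ennreal_mult_less_top)
  finally show ?thesis
    using f g by (auto simp: Lp_fun_def nn_integral_completion intro: bochner_integrable_add)
qed

lemma nn_integral_norm_powr_scaleR:
  assumes [measurable]: "(\<lambda>\<omega>. norm (f \<omega>)) \<in> borel_measurable (completion M)"
  shows "(\<integral>\<^sup>+\<omega>. ennreal (norm (c *\<^sub>R f \<omega>) powr p) \<partial>M) =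
    ennreal (\<bar>c\<bar> powr p) * (\<integral>\<^sup>+\<omega>. ennreal (norm (f \<omega>) powr p) \<partial>M)"
proof -
  have "(\<integral>\<^sup>+\<omega>. ennreal (norm (c *\<^sub>R f \<omega>) powr p) \<partial>completion M)
    = (\<integral>\<^sup>+\<omega>. ennreal (\<bar>c\<bar> powr p) * ennreal (norm (f \<omega>) powr p) \<partial>completion M)"
    by (simp add: ennreal_mult powr_mult)
  also have "\<dots> = ennreal (\<bar>c\<bar> powr p) * (\<integral>\<^sup>+\<omega>. ennreal (norm (f \<omega>) powr p) \<partial>completion M)"
    by (intro nn_integral_cmult) measurable
  finally show ?thesis by (simp only: nn_integral_completion)
qed

lemma Lp_fun_scaleR:
  assumes f: "f \<in> Lp_fun M p"
  shows "(\<lambda>\<omega>. c *\<^sub>R f \<omega>) \<in> Lp_fun M p"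
  using f nn_integral_norm_powr_scaleR[OF norm_bochner_measurable, of M f c p]
  by (auto simp: Lp_fun_def ennreal_mult_less_top intro: bochner_integrable_scaleR)

section \<open>The \<open>L\<^sup>1\<close> seminorm and separation by functionals\<close>

definition L1_norm :: "'w measure \<Rightarrow> ('w \<Rightarrow> 'x::banach) \<Rightarrow> real" where
  "L1_norm M f = enn2real (\<integral>\<^sup>+\<omega>. ennreal (norm (f \<omega>)) \<partial>M)"

lemma L1_norm_scaleR:
  assumes "f \<in> Lp_fun M p"
  shows "L1_norm M (\<lambda>\<omega>. c *\<^sub>R f \<omega>) = \<bar>c\<bar> * L1_norm M f"
  using assms nn_integral_norm_scaleR[OF norm_bochner_measurable, of M f c]
  by (simp add: L1_norm_def Lp_fun_def enn2real_mult)

lemma L1_norm_AE_zero: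
  assumes "AE \<omega> in M. f \<omega> = 0"
  shows "L1_norm M f = 0"
proof -
  have "(\<integral>\<^sup>+\<omega>. ennreal (norm (f \<omega>)) \<partial>M) = (\<integral>\<^sup>+\<omega>. 0 \<partial>M)"
    using assms by (intro nn_integral_cong_AE) (auto elim: eventually_mono)
  then show ?thesis by (simp add: L1_norm_def)
qed

context prob_space
begin

text \<open>Pointwise \<open>x \<le> 1 + x powr p\<close>, with cases split at \<open>x = 1\<close>,
  and the constant integrates to 1 because the total mass is 1.\<close>

lemma nn_integral_norm_le_powr:
  assumes p: "1 \<le> p" and [measurable]: "(\<lambda>\<omega>. norm (f \<omega>)) \<in> borel_measurable (completion M)"
  shows "(\<integral>\<^sup>+\<omega>. ennreal (norm (f \<omega>)) \<partial>M) \<le> 1 + (\<integral>\<^sup>+\<omega>. ennreal (norm (f \<omega>) powr p) \<partial>M)"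
proof -
  have "x \<le> 1 + x powr p" if "0 \<le> x" for x :: real
  proof (cases "x \<le> 1")
    case True
    then show ?thesis by (simp add: add_increasing2)
  next
    case False
    then have "x powr 1 \<le> x powr p" using p by (intro powr_mono) auto
    with False show ?thesis by simp
  qed
  then have "(\<integral>\<^sup>+\<omega>. ennreal (norm (f \<omega>)) \<partial>completion M)
    \<le> (\<integral>\<^sup>+\<omega>. 1 + ennreal (norm (f \<omega>) powr p) \<partial>completion M)"
    by (intro nn_integral_mono) (simp flip: ennreal_1 ennreal_plus)
  also have "\<dots> = 1 + (\<integral>\<^sup>+\<omega>. ennreal (norm (f \<omega>) powr p) \<partial>completion M)"
    by (subst nn_integral_add) (auto simp: emeasure_space_1)
  finally show ?thesis by (simp only: nn_integral_completion)
qed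

text \<open>Guards the use of \<open>enn2real\<close> in \<open>L1_norm\<close>: it sends infinity
  to 0, which would spoil subadditivity and the passage from value 0 to vanishing almost
  everywhere.\<close>

lemma Lp_fun_nn_integral_norm_finite:
  assumes p: "1 \<le> p" and f: "f \<in> Lp_fun M p"
  shows "(\<integral>\<^sup>+\<omega>. ennreal (norm (f \<omega>)) \<partial>M) < \<infinity>"
proof -
  have "(\<integral>\<^sup>+\<omega>. ennreal (norm (f \<omega>)) \<partial>M) \<le> 1 + (\<integral>\<^sup>+\<omega>. ennreal (norm (f \<omega>) powr p) \<partial>M)"
    using f by (intro nn_integral_norm_le_powr[OF p] norm_bochner_measurable) (simp add: Lp_fun_def)
  also have "\<dots> < \<infinity>" using f by (simp add: Lp_fun_def)
  finally show ?thesis .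
qed

lemma L1_norm_add:
  assumes p: "1 \<le> p" and f: "f \<in> Lp_fun M p" and g: "g \<in> Lp_fun M p"
  shows "L1_norm M (\<lambda>\<omega>. f \<omega> + g \<omega>) \<le> L1_norm M f + L1_norm M g"
proof -
  have [measurable]: "(\<lambda>\<omega>. norm (f \<omega>)) \<in> borel_measurable (completion M)"
    "(\<lambda>\<omega>. norm (g \<omega>)) \<in> borel_measurable (completion M)"
    using f g by (auto simp: Lp_fun_def intro: norm_bochner_measurable)
  have "(\<integral>\<^sup>+\<omega>. ennreal (norm (f \<omega> + g \<omega>)) \<partial>completion M) \<le>
    (\<integral>\<^sup>+\<omega>. ennreal (norm (f \<omega>)) + ennreal (norm (g \<omega>)) \<partial>completion M)"
    by (intro nn_integral_mono)
      (simp add: ennreal_plus[symmetric] norm_triangle_ineq del: ennreal_plus)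
  also have "\<dots> = (\<integral>\<^sup>+\<omega>. ennreal (norm (f \<omega>)) \<partial>completion M)
      + (\<integral>\<^sup>+\<omega>. ennreal (norm (g \<omega>)) \<partial>completion M)"
    by (intro nn_integral_add) measurable
  finally show ?thesis
    using Lp_fun_nn_integral_norm_finite[OF p f] Lp_fun_nn_integral_norm_finite[OF p g]
    by (simp add: L1_norm_def nn_integral_completion enn2real_plus[symmetric] enn2real_mono)
qed

lemma L1_norm_eq_0D:
  assumes p: "1 \<le> p" and f: "f \<in> Lp_fun M p" and "L1_norm M f = 0"
  shows "AE \<omega> in M. f \<omega> = 0"
proof -
  have [measurable]: "(\<lambda>\<omega>. norm (f \<omega>)) \<in> borel_measurable (completion M)"
    using f by (auto simp: Lp_fun_def intro: norm_bochner_measurable)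
  have "(\<integral>\<^sup>+\<omega>. ennreal (norm (f \<omega>)) \<partial>completion M) = 0"
    using Lp_fun_nn_integral_norm_finite[OF p f] assms(3)
    by (auto simp: L1_norm_def nn_integral_completion enn2real_eq_0_iff)
  then have "AE \<omega> in completion M. ennreal (norm (f \<omega>)) = 0"
    by (subst (asm) nn_integral_0_iff_AE) measurable
  then show ?thesis by (simp add: AE_completion_iff)
qed

text \<open>Makes linear functionals dominated by \<open>L1_norm\<close> continuous on
  \<open>L\<^sup>p\<close>. The constant 2 is \<open>1 + 1\<close> from
  \<open>nn_integral_norm_le_powr\<close> for a normalised function; the case \<open>I = 0\<close>
  cannot be normalised and is treated apart.\<close>

lemma L1_norm_le_Lp_norm:
  assumes p: "1 \<le> p" and f: "f \<in> Lp_fun M p"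
  shows "L1_norm M f \<le> 2 * Lp_norm M p (Lp_class M p f)"
proof -
  define I where "I = enn2real (\<integral>\<^sup>+\<omega>. ennreal (norm (f \<omega>) powr p) \<partial>M)"
  have I: "(\<integral>\<^sup>+\<omega>. ennreal (norm (f \<omega>) powr p) \<partial>M) = ennreal I" "0 \<le> I"
    using f by (auto simp: I_def Lp_fun_def)
  have [measurable]: "(\<lambda>\<omega>. norm (f \<omega>)) \<in> borel_measurable (completion M)"
    using f by (auto simp: Lp_fun_def intro: norm_bochner_measurable)
  have norm: "Lp_norm M p (Lp_class M p f) = I powr (1 / p)"
    using Lp_norm_class[OF f] by (simp add: I_def)
  show ?thesis
  proof (cases "I = 0")
    case True
    then have "(\<integral>\<^sup>+\<omega>. ennreal (norm (f \<omega>) powr p) \<partial>completion M) = 0"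
      using I by (simp add: nn_integral_completion)
    then have "AE \<omega> in completion M. ennreal (norm (f \<omega>) powr p) = 0"
      by (subst (asm) nn_integral_0_iff_AE) measurable
    then have "AE \<omega> in M. f \<omega> = 0" by (simp add: AE_completion_iff)
    then have "L1_norm M f = 0" by (rule L1_norm_AE_zero)
    then show ?thesis by (simp add: norm)
  next
    case False
    define N where "N = I powr (1 / p)"
    have N: "0 < N" "N powr p = I"
      using False I(2) p by (auto simp: N_def powr_powr)
    \<comment> \<open>Scaling to \<open>L\<^sup>p\<close> norm \<open>1\<close> makes \<open>x \<le> 1 + x\<^sup>p\<close> a substitute for Hoelder's inequality.\<close>
    define g where "g = (\<lambda>\<omega>. inverse N *\<^sub>R f \<omega>)"
    have g: "g \<in> Lp_fun M p"
      unfolding g_def using f by (rule Lp_fun_scaleR)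
    have "(\<integral>\<^sup>+\<omega>. ennreal (norm (g \<omega>) powr p) \<partial>M) = ennreal (inverse N powr p) * ennreal I"
      using nn_integral_norm_powr_scaleR[of f M "inverse N" p] N I by (simp add: g_def)
    also have "\<dots> = 1"
      using N False I(2) by (simp add: ennreal_mult[symmetric] inverse_eq_divide powr_divide)
    finally have "(\<integral>\<^sup>+\<omega>. ennreal (norm (g \<omega>)) \<partial>M) \<le> ennreal 2"
      using nn_integral_norm_le_powr[OF p norm_bochner_measurable, of g] g
      by (simp add: Lp_fun_def)
    then have "L1_norm M g \<le> 2"
      unfolding L1_norm_def by (rule enn2real_leI[rotated]) simp
    then have "L1_norm M f / N \<le> 2"
      using L1_norm_scaleR[OF f, of "inverse N"] N by (simp add: g_def divide_inverse mult.commute)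
    then show ?thesis
      using N by (simp add: norm N_def[symmetric] field_simps)
  qed
qed

text \<open>Hahn--Banach gives a linear functional equal to \<open>L1_norm\<close> at the difference
  of two representatives, where this seminorm is nonzero because the classes differ. Domination by
  \<open>L1_norm\<close> makes the functional blind to null sets, so it descends to classes.\<close>

lemma Lp_dual_separates:
  fixes u v :: "('a, 'x::banach) Lp_elem"
  assumes p: "1 \<le> p" and u: "u \<in> Lp_space M p" and v: "v \<in> Lp_space M p" and "u \<noteq> v"
  obtains l where "l \<in> Lp_dual M p" "l u \<noteq> l v"
proof -
  \<comment> \<open>Hahn--Banach is run on functions with pointwise operations; classes enter only
    through \<open>l\<close>.\<close>
  let ?scale = "\<lambda>c f \<omega>. c *\<^sub>R f \<omega> :: 'x"
  interpret vector_space ?scale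
    by standard (simp_all add: fun_eq_iff algebra_simps)
  interpret real_subspace ?scale "Lp_fun M p"
  proof
    show "subspace (Lp_fun M p)"
      using Lp_fun_zero Lp_fun_add[OF p] Lp_fun_scaleR
      by (auto simp: subspace_def zero_fun_def plus_fun_def)
  qed
  obtain f g where fg: "f \<in> Lp_fun M p" "g \<in> Lp_fun M p" and u_eq: "u = Lp_class M p f" and v_eq: "v = Lp_class M p g"
    using u v by (auto simp: Lp_space_def)
  \<comment> \<open>Written as a sum with a multiple so that closure of the subspace and linearity
    of \<open>L\<close> apply directly.\<close>
  define diff where "diff f g = f + ?scale (- 1) g" for f g :: "'a \<Rightarrow> 'x"
  have diff: "diff f g \<in> Lp_fun M p" if "f \<in> Lp_fun M p" "g \<in> Lp_fun M p" for f g
    unfolding diff_def using that by (intro V_closed)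
  have diff_eq: "diff f g \<omega> = f \<omega> - g \<omega>" for f g \<omega>
    by (simp add: diff_def)
  have "L1_norm M (diff f g) \<noteq> 0"
  proof
    assume "L1_norm M (diff f g) = 0"
    then have "AE \<omega> in M. f \<omega> = g \<omega>"
      using L1_norm_eq_0D[OF p diff[OF fg]] by (simp add: diff_eq)
    then have "(AE \<omega> in M. f \<omega> = k \<omega>) \<longleftrightarrow> (AE \<omega> in M. g \<omega> = k \<omega>)" for k
      by (intro eventually_subst) (auto elim: eventually_mono)
    then show False
      using \<open>u \<noteq> v\<close> by (simp add: u_eq v_eq Lp_class_def)
  qed
  have "sublinear (L1_norm M)"
    using L1_norm_add[OF p] by (auto simp: sublinear_def plus_fun_def L1_norm_scaleR)
  then obtain L where add: "\<And>x z. x \<in> Lp_fun M p \<Longrightarrow> z \<in> Lp_fun M p \<Longrightarrow> L (x + z) = L x + L z"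
    and scale: "\<And>c x. x \<in> Lp_fun M p \<Longrightarrow> L (?scale c x) = c * L x"
    and le: "\<And>x. x \<in> Lp_fun M p \<Longrightarrow> L x \<le> L1_norm M x"
    and L_eq: "L (diff f g) = L1_norm M (diff f g)"
    using hahn_banach[OF _ diff[OF fg]] by blast
  have abs_le: "\<bar>L x\<bar> \<le> L1_norm M x" if "x \<in> Lp_fun M p" for x
    using le[OF that] le[of "?scale (- 1) x"] scale[OF that, of "- 1"]
      L1_norm_scaleR[OF that, of "- 1"] Lp_fun_scaleR[OF that, of "- 1"] by (simp add: abs_le_iff)
  have L_diff: "L (diff x z) = L x - L z" if "x \<in> Lp_fun M p" "z \<in> Lp_fun M p" for x z
    using add[OF that(1) Lp_fun_scaleR[OF that(2), of "- 1"]] scale[OF that(2), of "- 1"]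
    by (simp add: diff_def)
  define l where "l w = L (SOME f. f \<in> w)" for w
  have l_class: "l (Lp_class M p x) = L x" if x: "x \<in> Lp_fun M p" for x
  proof -
    have "x \<in> Lp_class M p x" using x by (simp add: Lp_class_def)
    then have "(SOME f. f \<in> Lp_class M p x) \<in> Lp_class M p x" by (rule someI[where P = "\<lambda>f. f \<in> Lp_class M p x"])
    then obtain z where z: "z = (SOME f. f \<in> Lp_class M p x)" "z \<in> Lp_fun M p"
      and ae: "AE \<omega> in M. x \<omega> = z \<omega>"
      by (auto simp: Lp_class_def)
    \<comment> \<open>The chosen representative \<open>z\<close> differs from \<open>x\<close> only
      on a null set, so the bound on \<open>L (diff x z)\<close> forces
      \<open>L z = L x\<close>.\<close>
    have "L1_norm M (diff x z) = 0"
      using ae by (intro L1_norm_AE_zero) (simp add: diff_eq)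
    then show ?thesis
      using abs_le[OF diff[OF x z(2)]] L_diff[OF x z(2)] by (simp add: l_def z(1))
  qed
  have "l \<in> Lp_dual M p"
    unfolding Lp_dual_def
  proof (intro CollectI conjI ballI allI exI[of _ 2])
    fix f g :: "'a \<Rightarrow> 'x" assume fg: "f \<in> Lp_fun M p" "g \<in> Lp_fun M p"
    then show "l (Lp_class M p (\<lambda>\<omega>. f \<omega> + g \<omega>)) = l (Lp_class M p f) + l (Lp_class M p g)"
      using add[OF fg] Lp_fun_add[OF p fg] by (simp add: l_class plus_fun_def)
  next
    fix c and f :: "'a \<Rightarrow> 'x" assume f: "f \<in> Lp_fun M p"
    then show "l (Lp_class M p (\<lambda>\<omega>. c *\<^sub>R f \<omega>)) = c * l (Lp_class M p f)"
      using scale[OF f, of c] Lp_fun_scaleR[OF f, of c] by (simp add: l_class)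
  next
    fix w :: "('a, 'x) Lp_elem" assume "w \<in> Lp_space M p"
    then obtain f where f: "f \<in> Lp_fun M p" and w: "w = Lp_class M p f"
      by (auto simp: Lp_space_def)
    show "\<bar>l w\<bar> \<le> 2 * Lp_norm M p w"
      using abs_le[OF f] L1_norm_le_Lp_norm[OF p f] by (simp add: w l_class[OF f])
  qed
  moreover have "l u \<noteq> l v"
    using L_eq L_diff[OF fg] \<open>L1_norm M (diff f g) \<noteq> 0\<close> by (simp add: u_eq v_eq l_class fg)
  ultimately show thesis by (rule that)
qed

text \<open>Each point other than \<open>v\<close> lies in a subbasic set \<open>W l\<close> for a
  separating \<open>l\<close>, and no \<open>W l\<close> contains \<open>v\<close>.\<close>

lemma openin_Lp_weak_delete:
  fixes v :: "('a, 'b::banach) Lp_elem"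
  assumes p: "1 \<le> p" and v: "v \<in> Lp_space M p"
  shows "openin (Lp_weak M p) (Lp_space M p - {v})"
proof -
  define W where "W l = {u \<in> Lp_space M p. l u \<in> - {l v}}" for l :: "('a, 'b) Lp_elem \<Rightarrow> real"
  have "openin (Lp_weak M p) (W l)" if "l \<in> Lp_dual M p" for l
    unfolding Lp_weak_def openin_topology_generated_by_iff W_def
    by (rule generate_topology_on.Basis) (use that in blast)
  then have "openin (Lp_weak M p) (\<Union>l\<in>Lp_dual M p. W l)"
    by blast
  also have "(\<Union>l\<in>Lp_dual M p. W l) = Lp_space M p - {v}"
  proof (intro equalityI subsetI)
    fix u assume "u \<in> Lp_space M p - {v}"
    then obtain l where "l \<in> Lp_dual M p" "l u \<noteq> l v"
      using Lp_dual_separates[OF p _ v] by blast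
    with \<open>u \<in> Lp_space M p - {v}\<close> show "u \<in> (\<Union>l\<in>Lp_dual M p. W l)"
      by (auto simp: W_def)
  qed (auto simp: W_def)
  finally show ?thesis .
qed

end

section \<open>Complete trajectories\<close>

text \<open>The trajectory reaches \<open>\<phi> t\<close> from every earlier time, so attraction at
  time \<open>T\<close> would put \<open>\<phi> t\<close> into a neighbourhood chosen to avoid
  it.\<close>

lemma trajectory_in_attracting_set:
  assumes M: "prob_space M" and p: "1 \<le> p"
    and attr: "pullback_weakly_attracting M p \<Phi> \<D> \<A>" and sub: "\<A> t \<subseteq> Lp_space M p"
    and \<phi>: "complete_trajectory M p \<Phi> \<phi>" "(\<lambda>s. {\<phi> s}) \<in> \<D>"
  shows "\<phi> t \<in> \<A> t"
proof (rule ccontr)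
  assume "\<phi> t \<notin> \<A> t"
  have "\<phi> t \<in> Lp_space M p"
    using \<phi>(1) by (simp add: complete_trajectory_def)
  then have "weak_nbhd M p (\<A> t) (Lp_space M p - {\<phi> t})"
    using prob_space.openin_Lp_weak_delete[OF M p] sub \<open>\<phi> t \<notin> \<A> t\<close>
    unfolding weak_nbhd_def by blast
  then have "\<exists>T>0. \<forall>r\<ge>T. \<Phi> r (t - r) ` {\<phi> (t - r)} \<subseteq> Lp_space M p - {\<phi> t}"
    by (rule attr[unfolded pullback_weakly_attracting_def, THEN conjunct2, rule_format, OF \<phi>(2)])
  then obtain T where T: "0 < T" "\<Phi> T (t - T) (\<phi> (t - T)) \<noteq> \<phi> t"
    by auto
  have "\<phi> t = \<Phi> (t - (t - T)) (t - T) (\<phi> (t - T))"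
    using \<phi>(1) \<open>0 < T\<close> unfolding complete_trajectory_def by (metis diff_less_eq less_add_same_cancel1)
  with T(2) show False by simp
qed

text \<open>Preimages are chosen only at the countably many times \<open>t - real n\<close>, by
  dependent choice; the system itself fills in the times between and after them.\<close>

lemma trajectory_through_invariant_point:
  assumes rds: "mean_rds M p \<Phi>" and inv: "invariant_family \<Phi> \<A>"
    and sub: "\<And>s. \<A> s \<subseteq> Lp_space M p" and u: "u \<in> \<A> t"
  obtains \<phi> where "complete_trajectory M p \<Phi> \<phi>" "\<And>s. \<phi> s \<in> \<A> s" "\<phi> t = u"
proof -
  have comp: "\<Phi> (r + s) \<tau> w = \<Phi> r (s + \<tau>) (\<Phi> s \<tau> w)" if "0 \<le> r" "0 \<le> s" "w \<in> Lp_space M p" for r s \<tau> w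
    using rds that by (simp add: mean_rds_def)
  have id: "\<Phi> 0 \<tau> w = w" if "w \<in> Lp_space M p" for \<tau> w
    using rds that by (simp add: mean_rds_def)
  have inv_step: "\<A> s = \<Phi> r (s - r) ` \<A> (s - r)" if "0 \<le> r" for r s
    using inv that unfolding invariant_family_def by blast
  define \<theta> where "\<theta> n = t - real n" for n
  \<comment> \<open>The clause for \<open>n = 0\<close> anchors the sequence at \<open>u\<close>;
    invariance makes each time-one map onto, so a preimage can be picked.\<close>
  have "\<exists>w. \<forall>n. (w n \<in> \<A> (\<theta> n) \<and> (n = 0 \<longrightarrow> w n = u)) \<and> w n = \<Phi> 1 (\<theta> (Suc n)) (w (Suc n))"
  proof (rule dependent_nat_choice)
    show "\<exists>x. x \<in> \<A> (\<theta> 0) \<and> (0 = 0 \<longrightarrow> x = u)"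
      using u by (simp add: \<theta>_def)
    show "\<exists>y. (y \<in> \<A> (\<theta> (Suc n)) \<and> (Suc n = 0 \<longrightarrow> y = u)) \<and> x = \<Phi> 1 (\<theta> (Suc n)) y"
      if "x \<in> \<A> (\<theta> n) \<and> (n = 0 \<longrightarrow> x = u)" for x n
    proof -
      have "\<theta> n - 1 = \<theta> (Suc n)" by (simp add: \<theta>_def)
      from inv_step[OF zero_le_one, of "\<theta> n", unfolded this] that show ?thesis
        by blast
    qed
  qed
  then obtain w where wA: "\<And>n. w n \<in> \<A> (\<theta> n)" and w0: "w 0 = u"
    and w_Suc: "\<And>n. w n = \<Phi> 1 (\<theta> (Suc n)) (w (Suc n))"
    by blast
  have wL: "w n \<in> Lp_space M p" for n
    using wA sub by blast
  have w_shift: "w m = \<Phi> (real k) (\<theta> (m + k)) (w (m + k))" for m k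
  proof (induction k)
    case 0
    then show ?case by (simp add: id wL)
  next
    case (Suc k)
    have "1 + \<theta> (Suc (m + k)) = \<theta> (m + k)" by (simp add: \<theta>_def)
    then show ?case
      using Suc comp[of "real k" 1 "w (Suc (m + k))" "\<theta> (Suc (m + k))"] w_Suc[of "m + k"] wL
      by (simp add: add.commute)
  qed
  \<comment> \<open>The least \<open>n\<close> with \<open>\<theta> n \<le> s\<close>. For
    \<open>s \<ge> t\<close>, \<open>nat\<close> truncates to 0, so from \<open>t\<close> on the
    trajectory is the forward orbit of \<open>u\<close>.\<close>
  define N where "N s = nat \<lceil>t - s\<rceil>" for s
  have N: "\<theta> (N s) \<le> s" for s
    unfolding N_def \<theta>_def by linarith
  define \<phi> where "\<phi> s = \<Phi> (s - \<theta> (N s)) (\<theta> (N s)) (w (N s))" for s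
  \<comment> \<open>Starting further back on the grid gives the same value, so two times can be
    compared from a common grid point.\<close>
  have \<phi>_eq: "\<phi> s = \<Phi> (s - \<theta> n) (\<theta> n) (w n)" if le: "N s \<le> n" for s n
  proof -
    obtain k where n: "n = N s + k" using le_Suc_ex[OF le] by blast
    have shift: "real k + \<theta> n = \<theta> (N s)" by (simp add: n \<theta>_def)
    have "\<phi> s = \<Phi> (s - \<theta> (N s)) (real k + \<theta> n) (\<Phi> (real k) (\<theta> n) (w n))"
      unfolding \<phi>_def shift using w_shift[of "N s" k, folded n] by (rule arg_cong)
    also have "\<dots> = \<Phi> (s - \<theta> (N s) + real k) (\<theta> n) (w n)"
      using N[of s] wL by (intro comp[symmetric]) simp_all
    also have "s - \<theta> (N s) + real k = s - \<theta> n"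
      using shift by simp
    finally show ?thesis .
  qed
  have \<phi>A: "\<phi> s \<in> \<A> s" for s
  proof -
    have "\<A> s = \<Phi> (s - \<theta> (N s)) (\<theta> (N s)) ` \<A> (\<theta> (N s))"
      using inv_step[of "s - \<theta> (N s)" s] N[of s] by (simp only: diff_diff_eq2 add_diff_cancel_left' diff_ge_0_iff_ge)
    then show ?thesis
      unfolding \<phi>_def using wA by blast
  qed
  moreover have "\<phi> t = u"
    using \<phi>_eq[of t 0] wL[of 0] by (simp add: N_def \<theta>_def id w0)
  moreover have "complete_trajectory M p \<Phi> \<phi>"
    unfolding complete_trajectory_def
  proof (intro conjI allI impI)
    show "\<phi> s \<in> Lp_space M p" for s
      using \<phi>A sub by blast
    fix s r :: real assume "s < r"
    \<comment> \<open>The grid point of the earlier time \<open>s\<close> also serves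
      \<open>r\<close>; the cocycle law then joins the two values.\<close>
    then have "N r \<le> N s"
      unfolding N_def by (intro nat_mono ceiling_mono) simp
    then have "\<phi> r = \<Phi> (r - \<theta> (N s)) (\<theta> (N s)) (w (N s))"
      by (rule \<phi>_eq)
    also have "\<dots> = \<Phi> (r - s) s (\<phi> s)"
      using comp[of "r - s" "s - \<theta> (N s)" "w (N s)" "\<theta> (N s)"] N[of s] wL \<open>s < r\<close>
      by (simp add: \<phi>_def)
    finally show "\<phi> r = \<Phi> (r - s) s (\<phi> s)" .
  qed
  ultimately show thesis using that by blast
qed

theorem lemma6:
  fixes M :: "'w measure" and p :: real
    and \<D> :: "('w, 'x::banach) Lp_family set"
    and \<Phi> :: "('w, 'x) Lp_process"
    and \<A> :: "('w, 'x) Lp_family"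
  assumes "prob_space M"
    and "1 < p"
    and "bounded_collection M p \<D>"
    and "inclusion_closed M p \<D>"
    and "mean_rds M p \<Phi>"
    and "weak_pullback_attractor M p \<Phi> \<D> \<A>"
    and "invariant_family \<Phi> \<A>"
  shows "\<forall>t. \<A> t = {\<phi> t | \<phi>. complete_trajectory M p \<Phi> \<phi> \<and> (\<lambda>s. {\<phi> s}) \<in> \<D>}"
proof (intro allI equalityI subsetI)
  have attr: "pullback_weakly_attracting M p \<Phi> \<D> \<A>" and \<A>: "\<A> \<in> \<D>"
    using assms(6) by (auto simp: weak_pullback_attractor_def)
  have bdd: "Lp_bounded M p (\<A> s)" for s
    using \<A> assms(3) by (simp add: bounded_collection_def)
  then have sub: "\<A> s \<subseteq> Lp_space M p" for s
    by (simp add: Lp_bounded_def)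
  fix t u
  {
    assume "u \<in> \<A> t"
    then obtain \<phi> where \<phi>: "complete_trajectory M p \<Phi> \<phi>" "\<And>s. \<phi> s \<in> \<A> s" "\<phi> t = u"
      using trajectory_through_invariant_point[OF assms(5,7) sub] by blast
    \<comment> \<open>A norm bound for \<open>\<A> s\<close> also bounds the singleton, so
      \<open>inclusion_closed\<close> applies to the family of singletons.\<close>
    have "Lp_bounded M p {\<phi> s}" for s
      using bdd[of s] \<phi>(2)[of s] by (auto simp: Lp_bounded_def)
    then have "(\<lambda>s. {\<phi> s}) \<in> \<D>"
      using assms(4) \<A> \<phi>(2) by (auto simp: inclusion_closed_def)
    with \<phi> show "u \<in> {\<phi> t | \<phi>. complete_trajectory M p \<Phi> \<phi> \<and> (\<lambda>s. {\<phi> s}) \<in> \<D>}"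
      by blast
  next
    assume "u \<in> {\<phi> t | \<phi>. complete_trajectory M p \<Phi> \<phi> \<and> (\<lambda>s. {\<phi> s}) \<in> \<D>}"
    then show "u \<in> \<A> t"
      using trajectory_in_attracting_set[OF assms(1) less_imp_le[OF assms(2)] attr sub] by blast
  }
qed

end
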